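(* Let $E_\partial$ be the Courant algebroid associated to a gerbe with $0$-connection $(G,\partial)$ (over the complexified tangent bundle of a smooth manifold, or over the holomorphic tangent bundle of a complex manifold). Given an involutive isotropic subbundle $D\subset E_\partial$, regarded as a Lie algebroid, the gerbe $G$ obtains a canonical flat $D$-connection (canonical meaning determined by $(G,\partial,D)$, independently of the choice of local trivialization).
   Context: Gerbes. Let $M$ be a smooth (resp. complex) manifold and $\mathcal{O}_M$ its sheaf of smooth complex-valued (resp. holomorphic) functions; all bundles and sections are smooth (resp. holomorphic). A $\mathbb{C}^*$-gerbe $G$ trivialized over a cover $\{U_i\}$ is given by complex line bundles $L_{ij}$ on $U_{ij}$, with $L_{ji}$ dual to $L_{ij}$, and isomorphisms $\theta_{ijk}:L_{ij}\otimes L_{jk}\to L_{ik}$ with $\theta_{ikl}(\theta_{ijk}\otimes\mathrm{id})=\theta_{ijl}(\mathrm{id}\otimes\theta_{jkl})$ on $U_{ijkl}$. For a complex (resp. holomorphic) Lie algebroid $A$ with de Rham complex $(\Omega^\bullet_A,d_A)$, an $A$-connection on a line bundle $L$ is an operator $\partial:\mathcal{O}(L)\to\mathcal{O}(A^*\otimes L)$ with $\partial(fs)=d_Af\otimes s+f\partial s$; its curvature is $F_\partial=\partial^2\in\Omega^2_A(M)$. An $A$-connection on $G$ is a pair $(\partial,B)$: a $0$-connection $\partial$, i.e. $A$-connections $\partial_{ij}$ on $L_{ij}$ with $\partial_{ji}=\partial_{ij}^*$ and each $\theta_{ijk}$ flat; and a $1$-connection $B=\{B_i\in\Omega^2_A(U_i)\}$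 with $B_j-B_i=F_{\partial_{ij}}$. Its curving is the global $H\in\Omega^3_A(M)$ with $H|_{U_i}=d_AB_i$; it is flat if $H=0$. Changing local trivialization by line bundles with $A$-connection $(L_i,D_i)$ on $U_i$ replaces the data by $L_{ij}\otimes L_i\otimes L_j^*$, $\theta_{ijk}\otimes\mathrm{id}$, $\partial_{ij}+D_i+D_j^*$, $B_i-F_{D_i}$. Courant algebroids. On $\mathbb{T}M=TM\oplus T^*M$ (here $TM$ denotes the complexified, resp. holomorphic, tangent bundle) one has the pairing $\langle X+\xi,Y+\eta\rangle=\tfrac12(\xi(Y)+\eta(X))$ and the bracket $[X+\xi,Y+\eta]=[X,Y]+L_X\eta-i_Yd\xi$. An (exact) Courant algebroid is an extension $0\to T^*M\to E\xrightarrow{\pi}TM\to0$ with nondegenerate symmetric pairing and bracket on sections, locally isomorphic to $\mathbb{T}M$ through a splitting of $\pi$. The Courant algebroid $E_\partial$ canonically associated to a gerbe with $0$-connection (over $A=TM$) is obtained by gluing $\mathbb{T}U_i$ to $\mathbb{T}U_j$ over $U_{ij}$ by $X+\xi\mapsto X+\xi+i_XF_{\partial_{ij}}$. A subbundle $D$ is isotropic if the pairing vanishes on it and involutive if its sections are closed under the bracket; such a $D$ is a Lie algebroid with the restricted bracket and anchor $\pi|_D$. *)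

theory Defs
  imports "HOL-Analysis.Analysis" "HOL-Library.Function_Algebras"
begin

section \<open>Complex vector spaces\<close>

class cvec = ab_group_add +
  fixes scaleC :: "complex \<Rightarrow> 'a \<Rightarrow> 'a" (infixr "*\<^sub>C" 75)
  assumes scaleC_add_right: "c *\<^sub>C (x + y) = c *\<^sub>C x + c *\<^sub>C y"
    and scaleC_add_left: "(c + d) *\<^sub>C x = c *\<^sub>C x + d *\<^sub>C x"
    and scaleC_scaleC: "c *\<^sub>C d *\<^sub>C x = (c * d) *\<^sub>C x"
    and scaleC_one: "1 *\<^sub>C x = x"

instantiation complex :: cvec
begin
definition scaleC_complex :: "complex \<Rightarrow> complex \<Rightarrow> complex"
  where "scaleC_complex c x = c * x"
instance by standard (simp_all add: scaleC_complex_def algebra_simps)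
end

instantiation "fun" :: (type, cvec) cvec
begin
definition scaleC_fun :: "complex \<Rightarrow> ('a \<Rightarrow> 'b) \<Rightarrow> 'a \<Rightarrow> 'b"
  where "scaleC_fun c f = (\<lambda>x. c *\<^sub>C f x)"
instance
  by standard
    (simp_all add: scaleC_fun_def fun_eq_iff scaleC_add_right scaleC_add_left scaleC_scaleC scaleC_one)
end

instantiation prod :: (cvec, cvec) cvec
begin
definition scaleC_prod :: "complex \<Rightarrow> 'a \<times> 'b \<Rightarrow> 'a \<times> 'b"
  where "scaleC_prod c x = (c *\<^sub>C fst x, c *\<^sub>C snd x)"
instance
  by standard
    (simp_all add: scaleC_prod_def prod_eq_iff scaleC_add_right scaleC_add_left scaleC_scaleC scaleC_one)
end

definition csubspace :: "'v::cvec set \<Rightarrow> bool" where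
  "csubspace S \<longleftrightarrow> 0 \<in> S \<and> (\<forall>x\<in>S. \<forall>y\<in>S. x + y \<in> S) \<and> (\<forall>c. \<forall>x\<in>S. c *\<^sub>C x \<in> S)"

definition clinear_on :: "'v::cvec set \<Rightarrow> ('v \<Rightarrow> 'w::cvec) \<Rightarrow> bool" where
  "clinear_on S f \<longleftrightarrow> (\<forall>x\<in>S. \<forall>y\<in>S. f (x + y) = f x + f y) \<and> (\<forall>c. \<forall>x\<in>S. f (c *\<^sub>C x) = c *\<^sub>C f x)"

definition basis_of :: "'v::cvec set \<Rightarrow> nat \<Rightarrow> (nat \<Rightarrow> 'v) \<Rightarrow> bool" where
  "basis_of S r b \<longleftrightarrow>
     S = range (\<lambda>c. \<Sum>k<r. c k *\<^sub>C b k) \<and>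
     (\<forall>c. (\<Sum>k<r. c k *\<^sub>C b k) = 0 \<longrightarrow> (\<forall>k<r. c k = 0))"


section \<open>Smooth and complex manifolds\<close>

text \<open>
  Both kinds of manifold are handled together. The parameter \<open>K\<close> is either \<open>\<real>\<close> (as a set of
  complex numbers; smooth manifolds) or \<open>UNIV\<close> (complex manifolds), and the model space is
  \<open>K^n\<close>, embedded in \<open>nat \<Rightarrow> complex\<close> as the functions vanishing from index \<open>n\<close> on. Its topology as
  a subspace of the product topology is the usual one. Functions are always complex-valued, and
  the partial derivatives are taken along \<open>K\<close>: real partial derivatives for \<open>K = \<real>\<close>, complex ones
  for \<open>K = UNIV\<close>. Thus \<open>smooth_on\<close> means smooth and holomorphic, respectively.
\<close>

definition model :: "complex set \<Rightarrow> nat \<Rightarrow> (nat \<Rightarrow> complex) set" where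
  "model K n = {x. (\<forall>i<n. x i \<in> K) \<and> (\<forall>i\<ge>n. x i = 0)}"

fun C_k_on :: "complex set \<Rightarrow> nat \<Rightarrow> nat \<Rightarrow> (nat \<Rightarrow> complex) set \<Rightarrow> ((nat \<Rightarrow> complex) \<Rightarrow> complex) \<Rightarrow> bool"
where
  "C_k_on K n 0 V f \<longleftrightarrow> continuous_on V f"
| "C_k_on K n (Suc k) V f \<longleftrightarrow> continuous_on V f \<and>
     (\<forall>i<n. \<exists>g. C_k_on K n k V g \<and>
        (\<forall>x\<in>V. ((\<lambda>t. f (x(i := t))) has_field_derivative g x) (at (x i) within K)))"

definition smooth_on :: "complex set \<Rightarrow> nat \<Rightarrow> (nat \<Rightarrow> complex) set \<Rightarrow> ((nat \<Rightarrow> complex) \<Rightarrow> complex) \<Rightarrow> bool"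
  where "smooth_on K n V f \<longleftrightarrow> (\<forall>k. C_k_on K n k V f)"

type_synonym 'p chart = "'p set \<times> ('p \<Rightarrow> nat \<Rightarrow> complex)"

definition is_chart :: "complex set \<Rightarrow> nat \<Rightarrow> 'p::topological_space chart \<Rightarrow> bool" where
  "is_chart K n = (\<lambda>(U, \<phi>). open U \<and> openin (top_of_set (model K n)) (\<phi> ` U) \<and>
     homeomorphism U (\<phi> ` U) \<phi> (inv_into U \<phi>))"

definition manifold_atlas :: "complex set \<Rightarrow> nat \<Rightarrow> 'p::topological_space chart set \<Rightarrow> bool" where
  "manifold_atlas K n \<A> \<longleftrightarrow>
     (\<forall>c\<in>\<A>. is_chart K n c) \<and> (\<Union>c\<in>\<A>. fst c) = UNIV \<and>
     (\<forall>(U, \<phi>)\<in>\<A>. \<forall>(W, \<psi>)\<in>\<A>. \<forall>i<n. smooth_on K n (\<phi> ` (U \<inter> W)) (\<lambda>x. \<psi> (inv_into U \<phi> x) i))"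

text \<open>
  Functions and sections over an open set are represented by total functions that are zero
  outside it.
\<close>

definition rst :: "'p set \<Rightarrow> ('p \<Rightarrow> 'v::zero) \<Rightarrow> 'p \<Rightarrow> 'v" where
  "rst V s = (\<lambda>p. if p \<in> V then s p else 0)"

type_synonym 'p fsheaf = "'p set \<Rightarrow> ('p \<Rightarrow> complex) set"

definition structure_sheaf :: "complex set \<Rightarrow> nat \<Rightarrow> 'p chart set \<Rightarrow> 'p fsheaf" where
  "structure_sheaf K n \<A> V = {f. rst V f = f \<and>
     (\<forall>(U, \<phi>)\<in>\<A>. smooth_on K n (\<phi> ` (U \<inter> V)) (\<lambda>x. f (inv_into U \<phi> x)))}"

definition smooth_near :: "'p::topological_space fsheaf \<Rightarrow> 'p \<Rightarrow> ('p \<Rightarrow> complex) \<Rightarrow> bool" where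
  "smooth_near \<O> p f \<longleftrightarrow> (\<exists>V. open V \<and> p \<in> V \<and> rst V f \<in> \<O> V)"


section \<open>Vector bundles\<close>

text \<open>
  A bundle consists of its fibres, which are linear subspaces of an ambient complex vector space,
  and its smooth (holomorphic) local sections. The ambient space is no restriction, since the
  fibres of any family of bundles embed into the direct sum of all of them.
\<close>

record ('p, 'v) vbundle =
  fib :: "'p \<Rightarrow> 'v set"
  sec :: "'p set \<Rightarrow> ('p \<Rightarrow> 'v) set"

definition local_frame ::
  "'p::topological_space fsheaf \<Rightarrow> ('p, 'v::cvec, 'z) vbundle_scheme \<Rightarrow> 'p set \<Rightarrow> nat \<Rightarrow> (nat \<Rightarrow> 'p \<Rightarrow> 'v) \<Rightarrow> bool"
where
  "local_frame \<O> E V r e \<longleftrightarrow>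
     (\<forall>q\<in>V. basis_of (fib E q) r (\<lambda>k. e k q)) \<and>
     (\<forall>V' s. open V' \<and> V' \<subseteq> V \<longrightarrow>
        (s \<in> sec E V' \<longleftrightarrow> (\<exists>f. (\<forall>k<r. f k \<in> \<O> V') \<and> s = (\<lambda>q. \<Sum>k<r. f k q *\<^sub>C e k q))))"

definition vector_bundle ::
  "'p::topological_space fsheaf \<Rightarrow> 'p set \<Rightarrow> nat \<Rightarrow> ('p, 'v::cvec, 'z) vbundle_scheme \<Rightarrow> bool"
where
  "vector_bundle \<O> W r E \<longleftrightarrow>
     (\<forall>p\<in>W. csubspace (fib E p)) \<and>
     (\<forall>V V'. open V \<and> V \<subseteq> W \<and> open V' \<and> V' \<subseteq> V \<longrightarrow> (\<forall>s\<in>sec E V. rst V s = s \<and> rst V' s \<in> sec E V')) \<and>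
     (\<forall>V s. open V \<and> V \<subseteq> W \<and> rst V s = s \<and>
        (\<forall>p\<in>V. \<exists>V'. open V' \<and> p \<in> V' \<and> V' \<subseteq> V \<and> rst V' s \<in> sec E V') \<longrightarrow> s \<in> sec E V) \<and>
     (\<forall>p\<in>W. \<exists>V e. open V \<and> p \<in> V \<and> V \<subseteq> W \<and> local_frame \<O> E V r e)"

abbreviation line_bundle ::
  "'p::topological_space fsheaf \<Rightarrow> 'p set \<Rightarrow> ('p, 'v::cvec, 'z) vbundle_scheme \<Rightarrow> bool"
  where "line_bundle \<O> W L \<equiv> vector_bundle \<O> W 1 L"

definition dual_bundle ::
  "'p::topological_space fsheaf \<Rightarrow> ('p, 'v::cvec, 'z) vbundle_scheme \<Rightarrow> ('p, 'v \<Rightarrow> complex) vbundle"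
where
  "dual_bundle \<O> E = \<lparr>
     fib = (\<lambda>p. {\<phi>. clinear_on (fib E p) \<phi> \<and> (\<forall>v. v \<notin> fib E p \<longrightarrow> \<phi> v = 0)}),
     sec = (\<lambda>V. {\<phi>. rst V \<phi> = \<phi> \<and>
       (\<forall>p\<in>V. clinear_on (fib E p) (\<phi> p) \<and> (\<forall>v. v \<notin> fib E p \<longrightarrow> \<phi> p v = 0)) \<and>
       (\<forall>V' s. open V' \<and> V' \<subseteq> V \<and> s \<in> sec E V' \<longrightarrow> rst V' (\<lambda>p. \<phi> p (s p)) \<in> \<O> V')}) \<rparr>"


section \<open>Lie algebroids\<close>

text \<open>
  Tangent vectors at \<open>p\<close> are the complex derivations at \<open>p\<close> of germs of complex-valued smooth
  (holomorphic) functions, i.e. the elements of the complexified (holomorphic) tangent space.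
\<close>

type_synonym 'p tvec = "('p \<Rightarrow> complex) \<Rightarrow> complex"

definition tangent_space :: "'p::topological_space fsheaf \<Rightarrow> 'p \<Rightarrow> 'p tvec set" where
  "tangent_space \<O> p = {v.
     (\<forall>f. \<not> smooth_near \<O> p f \<longrightarrow> v f = 0) \<and>
     (\<forall>f g. smooth_near \<O> p f \<and> eventually (\<lambda>q. f q = g q) (nhds p) \<longrightarrow> v f = v g) \<and>
     (\<forall>f g. smooth_near \<O> p f \<and> smooth_near \<O> p g \<longrightarrow>
        v (\<lambda>q. f q + g q) = v f + v g \<and> v (\<lambda>q. f q * g q) = v f * g p + f p * v g) \<and>
     (\<forall>c f. smooth_near \<O> p f \<longrightarrow> v (\<lambda>q. c * f q) = c * v f)}"

definition lie_bracket ::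
  "'p::topological_space fsheaf \<Rightarrow> ('p \<Rightarrow> 'p tvec) \<Rightarrow> ('p \<Rightarrow> 'p tvec) \<Rightarrow> 'p \<Rightarrow> 'p tvec"
where
  "lie_bracket \<O> X Y p = (\<lambda>f. if smooth_near \<O> p f then X p (\<lambda>q. Y q f) - Y p (\<lambda>q. X q f) else 0)"

record ('p, 'a) algebroid = "('p, 'a) vbundle" +
  anchor :: "'p \<Rightarrow> 'a \<Rightarrow> 'p tvec"
  brk :: "'p set \<Rightarrow> ('p \<Rightarrow> 'a) \<Rightarrow> ('p \<Rightarrow> 'a) \<Rightarrow> 'p \<Rightarrow> 'a"

definition tangent_algebroid :: "'p::topological_space fsheaf \<Rightarrow> ('p, 'p tvec) algebroid" where
  "tangent_algebroid \<O> = \<lparr>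
     fib = tangent_space \<O>,
     sec = (\<lambda>V. {X. rst V X = X \<and> (\<forall>p\<in>V. X p \<in> tangent_space \<O> p) \<and>
        (\<forall>V' f. open V' \<and> V' \<subseteq> V \<and> f \<in> \<O> V' \<longrightarrow> rst V' (\<lambda>p. X p f) \<in> \<O> V')}),
     anchor = (\<lambda>p v. v),
     brk = (\<lambda>V X Y. rst V (lie_bracket \<O> X Y)) \<rparr>"

definition two_form ::
  "'p::topological_space fsheaf \<Rightarrow> ('p, 'a::cvec, 'z) vbundle_scheme \<Rightarrow> 'p set \<Rightarrow> ('p \<Rightarrow> 'a \<Rightarrow> 'a \<Rightarrow> complex) \<Rightarrow> bool"
where
  "two_form \<O> A W \<omega> \<longleftrightarrow>
     (\<forall>p\<in>W. \<forall>a\<in>fib A p. clinear_on (fib A p) (\<omega> p a) \<and> clinear_on (fib A p) (\<lambda>b. \<omega> p b a) \<and> \<omega> p a a = 0) \<and>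
     (\<forall>V. open V \<and> V \<subseteq> W \<longrightarrow> (\<forall>a\<in>sec A V. \<forall>b\<in>sec A V. rst V (\<lambda>p. \<omega> p (a p) (b p)) \<in> \<O> V))"

definition three_form ::
  "'p::topological_space fsheaf \<Rightarrow> ('p, 'a::cvec, 'z) vbundle_scheme \<Rightarrow> 'p set \<Rightarrow> ('p \<Rightarrow> 'a \<Rightarrow> 'a \<Rightarrow> 'a \<Rightarrow> complex) \<Rightarrow> bool"
where
  "three_form \<O> A W \<omega> \<longleftrightarrow>
     (\<forall>p\<in>W. \<forall>a\<in>fib A p. \<forall>b\<in>fib A p.
        clinear_on (fib A p) (\<omega> p a b) \<and> clinear_on (fib A p) (\<lambda>c. \<omega> p a c b) \<and> clinear_on (fib A p) (\<lambda>c. \<omega> p c a b) \<and>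
        \<omega> p a a b = 0 \<and> \<omega> p a b b = 0 \<and> \<omega> p a b a = 0) \<and>
     (\<forall>V. open V \<and> V \<subseteq> W \<longrightarrow>
        (\<forall>a\<in>sec A V. \<forall>b\<in>sec A V. \<forall>c\<in>sec A V. rst V (\<lambda>p. \<omega> p (a p) (b p) (c p)) \<in> \<O> V))"

text \<open>The values on sections over \<open>V\<close> of the algebroid differential of a 2-form.\<close>

definition d_two_form ::
  "('p, 'a, 'z) algebroid_scheme \<Rightarrow> 'p set \<Rightarrow> ('p \<Rightarrow> 'a \<Rightarrow> 'a \<Rightarrow> complex) \<Rightarrow>
   ('p \<Rightarrow> 'a) \<Rightarrow> ('p \<Rightarrow> 'a) \<Rightarrow> ('p \<Rightarrow> 'a) \<Rightarrow> 'p \<Rightarrow> complex"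
where
  "d_two_form A V \<omega> a b c p =
       anchor A p (a p) (\<lambda>q. \<omega> q (b q) (c q))
     - anchor A p (b p) (\<lambda>q. \<omega> q (a q) (c q))
     + anchor A p (c p) (\<lambda>q. \<omega> q (a q) (b q))
     - \<omega> p (brk A V a b p) (c p)
     + \<omega> p (brk A V a c p) (b p)
     - \<omega> p (brk A V b c p) (a p)"


section \<open>Connections on line bundles\<close>

text \<open>
  The value \<open>\<delta> V s p a\<close> of an \<open>A\<close>-connection is the derivative at \<open>p\<close>, in the direction \<open>a\<close> of the
  fibre of \<open>A\<close>, of the section \<open>s\<close> over \<open>V\<close>; the first two conditions below say that \<open>\<delta> V s\<close> is a
  section of the bundle of homomorphisms from \<open>A\<close> to \<open>L\<close>.
\<close>

type_synonym ('p, 'a, 'v) conn = "'p set \<Rightarrow> ('p \<Rightarrow> 'v) \<Rightarrow> 'p \<Rightarrow> 'a \<Rightarrow> 'v"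

definition connection ::
  "'p::topological_space fsheaf \<Rightarrow> ('p, 'a::cvec, 'z) algebroid_scheme \<Rightarrow> 'p set \<Rightarrow> ('p, 'v::cvec) vbundle \<Rightarrow>
   ('p, 'a, 'v) conn \<Rightarrow> bool"
where
  "connection \<O> A W L \<delta> \<longleftrightarrow> (\<forall>V. open V \<and> V \<subseteq> W \<longrightarrow> (\<forall>s\<in>sec L V.
     (\<forall>p\<in>V. clinear_on (fib A p) (\<delta> V s p) \<and> \<delta> V s p ` fib A p \<subseteq> fib L p) \<and>
     (\<forall>V' a. open V' \<and> V' \<subseteq> V \<and> a \<in> sec A V' \<longrightarrow> rst V' (\<lambda>p. \<delta> V s p (a p)) \<in> sec L V') \<and>
     (\<forall>V'. open V' \<and> V' \<subseteq> V \<longrightarrow> (\<forall>p\<in>V'. \<forall>a\<in>fib A p. \<delta> V' (rst V' s) p a = \<delta> V s p a)) \<and>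
     (\<forall>t\<in>sec L V. \<forall>p\<in>V. \<forall>a\<in>fib A p. \<delta> V (\<lambda>q. s q + t q) p a = \<delta> V s p a + \<delta> V t p a) \<and>
     (\<forall>f\<in>\<O> V. \<forall>p\<in>V. \<forall>a\<in>fib A p.
        \<delta> V (\<lambda>q. f q *\<^sub>C s q) p a = anchor A p a f *\<^sub>C s p + f p *\<^sub>C \<delta> V s p a)))"

definition cov_deriv ::
  "('p, 'a, 'v::zero) conn \<Rightarrow> 'p set \<Rightarrow> ('p \<Rightarrow> 'a) \<Rightarrow> ('p \<Rightarrow> 'v) \<Rightarrow> 'p \<Rightarrow> 'v"
  where "cov_deriv \<delta> V a s = rst V (\<lambda>p. \<delta> V s p (a p))"

definition is_curvature ::
  "'p::topological_space fsheaf \<Rightarrow> ('p, 'a::cvec, 'z) algebroid_scheme \<Rightarrow> 'p set \<Rightarrow> ('p, 'v::cvec) vbundle \<Rightarrow>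
   ('p, 'a, 'v) conn \<Rightarrow> ('p \<Rightarrow> 'a \<Rightarrow> 'a \<Rightarrow> complex) \<Rightarrow> bool"
where
  "is_curvature \<O> A W L \<delta> F \<longleftrightarrow> two_form \<O> A W F \<and>
     (\<forall>V. open V \<and> V \<subseteq> W \<longrightarrow> (\<forall>a\<in>sec A V. \<forall>b\<in>sec A V. \<forall>s\<in>sec L V. \<forall>p\<in>V.
        F p (a p) (b p) *\<^sub>C s p =
          cov_deriv \<delta> V a (cov_deriv \<delta> V b s) p - cov_deriv \<delta> V b (cov_deriv \<delta> V a s) p
          - cov_deriv \<delta> V (brk A V a b) s p))"

definition dual_conn ::
  "'p::topological_space fsheaf \<Rightarrow> ('p, 'a, 'z) algebroid_scheme \<Rightarrow> ('p, 'v::cvec) vbundle \<Rightarrow>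
   ('p, 'a, 'v) conn \<Rightarrow> ('p, 'a, 'v \<Rightarrow> complex) conn"
where
  "dual_conn \<O> A L \<delta> V \<phi> p a = (THE \<kappa>. \<kappa> \<in> fib (dual_bundle \<O> L) p \<and>
     (\<forall>V' s. open V' \<and> p \<in> V' \<and> V' \<subseteq> V \<and> s \<in> sec L V' \<longrightarrow>
        \<kappa> (s p) = anchor A p a (\<lambda>q. \<phi> q (s q)) - \<phi> p (\<delta> V' s p a)))"


section \<open>Gerbes\<close>

text \<open>
  The index set of the cover is a whole type, but members of the cover may be empty, so that
  smaller index sets are included. \<open>dpair i j p\<close> is the duality pairing of the fibres at \<open>p\<close> of
  \<open>lb i j\<close> and \<open>lb j i\<close>. The isomorphism \<open>theta i j k\<close> from the tensor product of \<open>lb i j\<close> and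
  \<open>lb j k\<close> to \<open>lb i k\<close> is given by the corresponding bilinear map of fibres. As these are
  one-dimensional, it is an isomorphism iff non-zero arguments have non-zero values; its inverse
  is then automatically smooth (holomorphic).
\<close>

record ('p, 'i, 'v) gerbe =
  cover :: "'i \<Rightarrow> 'p set"
  lb :: "'i \<Rightarrow> 'i \<Rightarrow> ('p, 'v) vbundle"
  dpair :: "'i \<Rightarrow> 'i \<Rightarrow> 'p \<Rightarrow> 'v \<Rightarrow> 'v \<Rightarrow> complex"
  theta :: "'i \<Rightarrow> 'i \<Rightarrow> 'i \<Rightarrow> 'p \<Rightarrow> 'v \<Rightarrow> 'v \<Rightarrow> 'v"

definition gerbe :: "'p::topological_space fsheaf \<Rightarrow> ('p, 'i, 'v::cvec) gerbe \<Rightarrow> bool" where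
  "gerbe \<O> G \<longleftrightarrow>
     (\<forall>i. open (cover G i)) \<and> (\<Union>i. cover G i) = UNIV \<and>
     (\<forall>i j. line_bundle \<O> (cover G i \<inter> cover G j) (lb G i j)) \<and>
     (\<forall>i j. \<forall>p\<in>cover G i \<inter> cover G j. \<forall>x\<in>fib (lb G i j) p. \<forall>y\<in>fib (lb G j i) p.
        clinear_on (fib (lb G j i) p) (dpair G i j p x) \<and>
        dpair G i j p x y = dpair G j i p y x \<and>
        (x \<noteq> 0 \<and> y \<noteq> 0 \<longrightarrow> dpair G i j p x y \<noteq> 0)) \<and>
     (\<forall>i j V. open V \<and> V \<subseteq> cover G i \<inter> cover G j \<longrightarrow>
        (\<forall>s\<in>sec (lb G i j) V. \<forall>t\<in>sec (lb G j i) V. rst V (\<lambda>p. dpair G i j p (s p) (t p)) \<in> \<O> V)) \<and>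
     (\<forall>i j k. \<forall>p\<in>cover G i \<inter> cover G j \<inter> cover G k. \<forall>x\<in>fib (lb G i j) p. \<forall>y\<in>fib (lb G j k) p.
        theta G i j k p x y \<in> fib (lb G i k) p \<and>
        clinear_on (fib (lb G j k) p) (theta G i j k p x) \<and>
        clinear_on (fib (lb G i j) p) (\<lambda>z. theta G i j k p z y) \<and>
        (x \<noteq> 0 \<and> y \<noteq> 0 \<longrightarrow> theta G i j k p x y \<noteq> 0)) \<and>
     (\<forall>i j k V. open V \<and> V \<subseteq> cover G i \<inter> cover G j \<inter> cover G k \<longrightarrow>
        (\<forall>s\<in>sec (lb G i j) V. \<forall>t\<in>sec (lb G j k) V.
           rst V (\<lambda>p. theta G i j k p (s p) (t p)) \<in> sec (lb G i k) V)) \<and>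
     (\<forall>i j k l. \<forall>p\<in>cover G i \<inter> cover G j \<inter> cover G k \<inter> cover G l.
        \<forall>x\<in>fib (lb G i j) p. \<forall>y\<in>fib (lb G j k) p. \<forall>z\<in>fib (lb G k l) p.
          theta G i k l p (theta G i j k p x y) z = theta G i j l p x (theta G j k l p y z))"

type_synonym ('p, 'i, 'a, 'v) conn0 = "'i \<Rightarrow> 'i \<Rightarrow> ('p, 'a, 'v) conn"
type_synonym ('p, 'i, 'a) conn1 = "'i \<Rightarrow> 'p \<Rightarrow> 'a \<Rightarrow> 'a \<Rightarrow> complex"

definition zero_connection ::
  "'p::topological_space fsheaf \<Rightarrow> ('p, 'a::cvec, 'z) algebroid_scheme \<Rightarrow> ('p, 'i, 'v::cvec) gerbe \<Rightarrow>
   ('p, 'i, 'a, 'v) conn0 \<Rightarrow> bool"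
where
  "zero_connection \<O> A G \<delta> \<longleftrightarrow>
     (\<forall>i j. connection \<O> A (cover G i \<inter> cover G j) (lb G i j) (\<delta> i j)) \<and>
     (\<forall>i j V. open V \<and> V \<subseteq> cover G i \<inter> cover G j \<longrightarrow>
        (\<forall>s\<in>sec (lb G i j) V. \<forall>t\<in>sec (lb G j i) V. \<forall>p\<in>V. \<forall>a\<in>fib A p.
           anchor A p a (\<lambda>q. dpair G i j q (s q) (t q)) =
             dpair G i j p (\<delta> i j V s p a) (t p) + dpair G i j p (s p) (\<delta> j i V t p a))) \<and>
     (\<forall>i j k V. open V \<and> V \<subseteq> cover G i \<inter> cover G j \<inter> cover G k \<longrightarrow>
        (\<forall>s\<in>sec (lb G i j) V. \<forall>t\<in>sec (lb G j k) V. \<forall>p\<in>V. \<forall>a\<in>fib A p.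
           \<delta> i k V (rst V (\<lambda>q. theta G i j k q (s q) (t q))) p a =
             theta G i j k p (\<delta> i j V s p a) (t p) + theta G i j k p (s p) (\<delta> j k V t p a)))"

definition gerbe_connection ::
  "'p::topological_space fsheaf \<Rightarrow> ('p, 'a::cvec, 'z) algebroid_scheme \<Rightarrow> ('p, 'i, 'v::cvec) gerbe \<Rightarrow>
   ('p, 'i, 'a, 'v) conn0 \<times> ('p, 'i, 'a) conn1 \<Rightarrow> bool"
where
  "gerbe_connection \<O> A G = (\<lambda>(\<delta>, B). zero_connection \<O> A G \<delta> \<and>
     (\<forall>i. two_form \<O> A (cover G i) (B i)) \<and>
     (\<forall>i j. is_curvature \<O> A (cover G i \<inter> cover G j) (lb G i j) (\<delta> i j) (\<lambda>p a b. B j p a b - B i p a b)))"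

definition is_curving ::
  "'p::topological_space fsheaf \<Rightarrow> ('p, 'a::cvec, 'z) algebroid_scheme \<Rightarrow> ('p, 'i, 'v::cvec) gerbe \<Rightarrow>
   ('p, 'i, 'a) conn1 \<Rightarrow> ('p \<Rightarrow> 'a \<Rightarrow> 'a \<Rightarrow> 'a \<Rightarrow> complex) \<Rightarrow> bool"
where
  "is_curving \<O> A G B H \<longleftrightarrow> three_form \<O> A UNIV H \<and>
     (\<forall>i V. open V \<and> V \<subseteq> cover G i \<longrightarrow> (\<forall>a\<in>sec A V. \<forall>b\<in>sec A V. \<forall>c\<in>sec A V. \<forall>p\<in>V.
        H p (a p) (b p) (c p) = d_two_form A V (B i) a b c p))"

definition flat_gerbe_connection ::
  "'p::topological_space fsheaf \<Rightarrow> ('p, 'a::cvec, 'z) algebroid_scheme \<Rightarrow> ('p, 'i, 'v::cvec) gerbe \<Rightarrow>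
   ('p, 'i, 'a, 'v) conn0 \<times> ('p, 'i, 'a) conn1 \<Rightarrow> bool"
where
  "flat_gerbe_connection \<O> A G C \<longleftrightarrow>
     gerbe_connection \<O> A G C \<and> is_curving \<O> A G (snd C) (\<lambda>p a b c. 0)"


section \<open>The Courant algebroid of a gerbe with 0-connection\<close>

text \<open>
  An element over \<open>p\<close> of the glued bundle is represented by all its local representatives
  \<open>X + \<xi> i\<close>, where \<open>i\<close> ranges over the indices with \<open>p \<in> cover G i\<close>. The gluing maps leave the vector
  part \<open>X\<close> unchanged. The 2-form \<open>F\<close> in the gluing condition is the curvature of \<open>\<delta> i j\<close>, of which
  there is exactly one.
\<close>

type_synonym ('p, 'i) evec = "'p tvec \<times> ('i \<Rightarrow> 'p tvec \<Rightarrow> complex)"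

definition courant_fibre ::
  "'p::topological_space fsheaf \<Rightarrow> ('p, 'i, 'v::cvec) gerbe \<Rightarrow> ('p, 'i, 'p tvec, 'v) conn0 \<Rightarrow> 'p \<Rightarrow> ('p, 'i) evec set"
where
  "courant_fibre \<O> G \<delta> p = {(X, \<xi>). X \<in> tangent_space \<O> p \<and>
     (\<forall>i. if p \<in> cover G i then \<xi> i \<in> fib (dual_bundle \<O> (tangent_algebroid \<O>)) p else \<xi> i = 0) \<and>
     (\<forall>i j. p \<in> cover G i \<inter> cover G j \<longrightarrow>
        (\<exists>F. is_curvature \<O> (tangent_algebroid \<O>) (cover G i \<inter> cover G j) (lb G i j) (\<delta> i j) F \<and>
             (\<forall>v\<in>tangent_space \<O> p. \<xi> j v = \<xi> i v + F p X v)))}"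

definition courant_bundle ::
  "'p::topological_space fsheaf \<Rightarrow> ('p, 'i, 'v::cvec) gerbe \<Rightarrow> ('p, 'i, 'p tvec, 'v) conn0 \<Rightarrow>
   ('p, ('p, 'i) evec) vbundle"
where
  "courant_bundle \<O> G \<delta> = \<lparr>
     fib = courant_fibre \<O> G \<delta>,
     sec = (\<lambda>V. {e. rst V e = e \<and> (\<forall>p\<in>V. e p \<in> courant_fibre \<O> G \<delta> p) \<and>
       (\<lambda>p. fst (e p)) \<in> sec (tangent_algebroid \<O>) V \<and>
       (\<forall>i. rst (V \<inter> cover G i) (\<lambda>p. snd (e p) i)
              \<in> sec (dual_bundle \<O> (tangent_algebroid \<O>)) (V \<inter> cover G i))}) \<rparr>"

text \<open>The pairing and the bracket in the \<open>i\<close>-th local representation.\<close>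

definition courant_pairing :: "'i \<Rightarrow> ('p, 'i) evec \<Rightarrow> ('p, 'i) evec \<Rightarrow> complex" where
  "courant_pairing i e e' = (snd e i (fst e') + snd e' i (fst e)) / 2"

definition lie_deriv_form ::
  "'p::topological_space fsheaf \<Rightarrow> ('p \<Rightarrow> 'p tvec) \<Rightarrow> ('p \<Rightarrow> 'p tvec \<Rightarrow> complex) \<Rightarrow> ('p \<Rightarrow> 'p tvec) \<Rightarrow> 'p \<Rightarrow> complex"
where
  "lie_deriv_form \<O> X \<eta> Z p = X p (\<lambda>q. \<eta> q (Z q)) - \<eta> p (lie_bracket \<O> X Z p)"

definition d_one_form ::
  "'p::topological_space fsheaf \<Rightarrow> ('p \<Rightarrow> 'p tvec \<Rightarrow> complex) \<Rightarrow> ('p \<Rightarrow> 'p tvec) \<Rightarrow> ('p \<Rightarrow> 'p tvec) \<Rightarrow> 'p \<Rightarrow> complex"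
where
  "d_one_form \<O> \<xi> Y Z p =
     Y p (\<lambda>q. \<xi> q (Z q)) - Z p (\<lambda>q. \<xi> q (Y q)) - \<xi> p (lie_bracket \<O> Y Z p)"

text \<open>
  \<open>e''\<close> is the Courant bracket of \<open>e\<close> and \<open>e'\<close> over \<open>V\<close>: with \<open>e = X + \<xi>\<close> and \<open>e' = Y + \<eta>\<close>, its
  vector part is the Lie bracket of \<open>X\<close> and \<open>Y\<close>, and its covector part takes on each local vector
  field \<open>Z\<close> the same value as the Lie derivative of \<open>\<eta>\<close> along \<open>X\<close> minus the contraction of \<open>d\<xi>\<close> with
  \<open>Y\<close>. There is exactly one such section, so that \<open>SOME\<close> in
  the bracket of \<open>sub_algebroid\<close> below involves no choice.
\<close>

definition is_courant_bracket ::
  "'p::topological_space fsheaf \<Rightarrow> ('p, 'i, 'v::cvec) gerbe \<Rightarrow> ('p, 'i, 'p tvec, 'v) conn0 \<Rightarrow> 'p set \<Rightarrow>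
   ('p \<Rightarrow> ('p, 'i) evec) \<Rightarrow> ('p \<Rightarrow> ('p, 'i) evec) \<Rightarrow> ('p \<Rightarrow> ('p, 'i) evec) \<Rightarrow> bool"
where
  "is_courant_bracket \<O> G \<delta> V e e' e'' \<longleftrightarrow> e'' \<in> sec (courant_bundle \<O> G \<delta>) V \<and>
     (\<forall>p\<in>V. fst (e'' p) = lie_bracket \<O> (\<lambda>q. fst (e q)) (\<lambda>q. fst (e' q)) p) \<and>
     (\<forall>i V' Z. open V' \<and> V' \<subseteq> V \<inter> cover G i \<and> Z \<in> sec (tangent_algebroid \<O>) V' \<longrightarrow>
        (\<forall>p\<in>V'. snd (e'' p) i (Z p) =
           lie_deriv_form \<O> (\<lambda>q. fst (e q)) (\<lambda>q. snd (e' q) i) Z p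
           - d_one_form \<O> (\<lambda>q. snd (e q) i) (\<lambda>q. fst (e' q)) Z p))"

text \<open>A subbundle is given by its fibres; its rank may differ between components of the manifold.\<close>

definition subbundle ::
  "('p::topological_space, 'v::cvec, 'z) vbundle_scheme \<Rightarrow> ('p \<Rightarrow> 'v set) \<Rightarrow> bool"
where
  "subbundle E D \<longleftrightarrow>
     (\<forall>p. csubspace (D p) \<and> D p \<subseteq> fib E p) \<and>
     (\<forall>p. \<exists>V r e. open V \<and> p \<in> V \<and> (\<forall>k<r. e k \<in> sec E V) \<and> (\<forall>q\<in>V. basis_of (D q) r (\<lambda>k. e k q)))"

definition sub_sec :: "('p, 'v, 'z) vbundle_scheme \<Rightarrow> ('p \<Rightarrow> 'v set) \<Rightarrow> 'p set \<Rightarrow> ('p \<Rightarrow> 'v) set" where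
  "sub_sec E D V = {s \<in> sec E V. \<forall>p\<in>V. s p \<in> D p}"

definition isotropic :: "('p, 'i, 'v) gerbe \<Rightarrow> ('p \<Rightarrow> ('p, 'i) evec set) \<Rightarrow> bool" where
  "isotropic G D \<longleftrightarrow> (\<forall>i. \<forall>p\<in>cover G i. \<forall>e\<in>D p. \<forall>e'\<in>D p. courant_pairing i e e' = 0)"

definition involutive ::
  "'p::topological_space fsheaf \<Rightarrow> ('p, 'i, 'v::cvec) gerbe \<Rightarrow> ('p, 'i, 'p tvec, 'v) conn0 \<Rightarrow>
   ('p \<Rightarrow> ('p, 'i) evec set) \<Rightarrow> bool"
where
  "involutive \<O> G \<delta> D \<longleftrightarrow> (\<forall>V. open V \<longrightarrow>
     (\<forall>e\<in>sub_sec (courant_bundle \<O> G \<delta>) D V. \<forall>e'\<in>sub_sec (courant_bundle \<O> G \<delta>) D V.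
        \<exists>e''\<in>sub_sec (courant_bundle \<O> G \<delta>) D V. is_courant_bracket \<O> G \<delta> V e e' e''))"

definition sub_algebroid ::
  "'p::topological_space fsheaf \<Rightarrow> ('p, 'i, 'v::cvec) gerbe \<Rightarrow> ('p, 'i, 'p tvec, 'v) conn0 \<Rightarrow>
   ('p \<Rightarrow> ('p, 'i) evec set) \<Rightarrow> ('p, ('p, 'i) evec) algebroid"
where
  "sub_algebroid \<O> G \<delta> D = \<lparr>
     fib = D,
     sec = sub_sec (courant_bundle \<O> G \<delta>) D,
     anchor = (\<lambda>p e. fst e),
     brk = (\<lambda>V e e'. SOME e''. e'' \<in> sub_sec (courant_bundle \<O> G \<delta>) D V \<and> is_courant_bracket \<O> G \<delta> V e e' e'') \<rparr>"


section \<open>Changes of local trivialization\<close>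

text \<open>
  A change of local trivialization first passes to a refinement of the cover, along a map \<open>rtau\<close> of
  indices, and then tensors with line bundles \<open>rline j\<close> with connection \<open>rconn j\<close> of curvature
  \<open>rcurv j\<close>. The new line bundles need only be isomorphic to the tensor products: \<open>rmap j k p\<close> is
  the trilinear map of fibres that gives the isomorphism from the tensor product of
  \<open>lb G (rtau j) (rtau k)\<close>, \<open>rline j\<close> and the dual of \<open>rline k\<close> to \<open>lb G' j k\<close>.
\<close>

record ('p, 'i, 'v) retriv =
  rtau :: "'i \<Rightarrow> 'i"
  rline :: "'i \<Rightarrow> ('p, 'v) vbundle"
  rconn :: "'i \<Rightarrow> ('p, 'p tvec, 'v) conn"
  rcurv :: "'i \<Rightarrow> 'p \<Rightarrow> 'p tvec \<Rightarrow> 'p tvec \<Rightarrow> complex"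
  rmap :: "'i \<Rightarrow> 'i \<Rightarrow> 'p \<Rightarrow> 'v \<Rightarrow> 'v \<Rightarrow> ('v \<Rightarrow> complex) \<Rightarrow> 'v"

definition gerbe_retriv ::
  "'p::topological_space fsheaf \<Rightarrow> ('p, 'i, 'v) retriv \<Rightarrow> ('p, 'i, 'v::cvec) gerbe \<Rightarrow> ('p, 'i, 'v) gerbe \<Rightarrow> bool"
where
  "gerbe_retriv \<O> R G G' \<longleftrightarrow>
     (\<forall>j. cover G' j \<subseteq> cover G (rtau R j)) \<and>
     (\<forall>j. line_bundle \<O> (cover G' j) (rline R j)) \<and>
     (\<forall>j k. \<forall>p\<in>cover G' j \<inter> cover G' k.
        \<forall>x\<in>fib (lb G (rtau R j) (rtau R k)) p. \<forall>t\<in>fib (rline R j) p. \<forall>\<phi>\<in>fib (dual_bundle \<O> (rline R k)) p.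
          rmap R j k p x t \<phi> \<in> fib (lb G' j k) p \<and>
          clinear_on (fib (lb G (rtau R j) (rtau R k)) p) (\<lambda>y. rmap R j k p y t \<phi>) \<and>
          clinear_on (fib (rline R j) p) (\<lambda>u. rmap R j k p x u \<phi>) \<and>
          clinear_on (fib (dual_bundle \<O> (rline R k)) p) (rmap R j k p x t) \<and>
          (x \<noteq> 0 \<and> t \<noteq> 0 \<and> \<phi> \<noteq> 0 \<longrightarrow> rmap R j k p x t \<phi> \<noteq> 0)) \<and>
     (\<forall>j k V. open V \<and> V \<subseteq> cover G' j \<inter> cover G' k \<longrightarrow>
        (\<forall>s\<in>sec (lb G (rtau R j) (rtau R k)) V. \<forall>t\<in>sec (rline R j) V. \<forall>\<phi>\<in>sec (dual_bundle \<O> (rline R k)) V.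
           rst V (\<lambda>p. rmap R j k p (s p) (t p) (\<phi> p)) \<in> sec (lb G' j k) V)) \<and>
     (\<forall>j k. \<forall>p\<in>cover G' j \<inter> cover G' k.
        \<forall>x\<in>fib (lb G (rtau R j) (rtau R k)) p. \<forall>t\<in>fib (rline R j) p. \<forall>\<phi>\<in>fib (dual_bundle \<O> (rline R k)) p.
        \<forall>y\<in>fib (lb G (rtau R k) (rtau R j)) p. \<forall>u\<in>fib (rline R k) p. \<forall>\<kappa>\<in>fib (dual_bundle \<O> (rline R j)) p.
          dpair G' j k p (rmap R j k p x t \<phi>) (rmap R k j p y u \<kappa>) =
            dpair G (rtau R j) (rtau R k) p x y * \<phi> u * \<kappa> t) \<and>
     (\<forall>j k l. \<forall>p\<in>cover G' j \<inter> cover G' k \<inter> cover G' l.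
        \<forall>x\<in>fib (lb G (rtau R j) (rtau R k)) p. \<forall>t\<in>fib (rline R j) p. \<forall>\<phi>\<in>fib (dual_bundle \<O> (rline R k)) p.
        \<forall>y\<in>fib (lb G (rtau R k) (rtau R l)) p. \<forall>u\<in>fib (rline R k) p. \<forall>\<kappa>\<in>fib (dual_bundle \<O> (rline R l)) p.
          theta G' j k l p (rmap R j k p x t \<phi>) (rmap R k l p y u \<kappa>) =
            \<phi> u *\<^sub>C rmap R j l p (theta G (rtau R j) (rtau R k) (rtau R l) p x y) t \<kappa>)"

text \<open>
  The transformation rules for \<open>A\<close>-connections, where the line bundles \<open>rline R j\<close> carry the
  \<open>A\<close>-connections \<open>\<Delta> j\<close>. The connection on \<open>G'\<close> is one over an algebroid whose fibres are identified
  with those of \<open>A\<close> by \<open>\<psi>\<close>.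
\<close>

definition conn0_retriv ::
  "'p::topological_space fsheaf \<Rightarrow> ('p, 'a::cvec, 'z) algebroid_scheme \<Rightarrow> ('p, 'i, 'v::cvec) retriv \<Rightarrow>
   ('p, 'i, 'v) gerbe \<Rightarrow> ('p, 'i, 'v) gerbe \<Rightarrow> ('i \<Rightarrow> ('p, 'a, 'v) conn) \<Rightarrow> ('p \<Rightarrow> 'a \<Rightarrow> 'b) \<Rightarrow>
   ('p, 'i, 'a, 'v) conn0 \<Rightarrow> ('p, 'i, 'b, 'v) conn0 \<Rightarrow> bool"
where
  "conn0_retriv \<O> A R G G' \<Delta> \<psi> \<delta> \<delta>' \<longleftrightarrow>
     (\<forall>j. connection \<O> A (cover G' j) (rline R j) (\<Delta> j)) \<and>
     (\<forall>j k V. open V \<and> V \<subseteq> cover G' j \<inter> cover G' k \<longrightarrow>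
        (\<forall>s\<in>sec (lb G (rtau R j) (rtau R k)) V. \<forall>t\<in>sec (rline R j) V. \<forall>\<phi>\<in>sec (dual_bundle \<O> (rline R k)) V.
         \<forall>p\<in>V. \<forall>a\<in>fib A p.
           \<delta>' j k V (rst V (\<lambda>q. rmap R j k q (s q) (t q) (\<phi> q))) p (\<psi> p a) =
             rmap R j k p (\<delta> (rtau R j) (rtau R k) V s p a) (t p) (\<phi> p)
             + rmap R j k p (s p) (\<Delta> j V t p a) (\<phi> p)
             + rmap R j k p (s p) (t p) (dual_conn \<O> A (rline R k) (\<Delta> k) V \<phi> p a)))"

definition conn1_retriv ::
  "'p::topological_space fsheaf \<Rightarrow> ('p, 'a::cvec, 'z) algebroid_scheme \<Rightarrow> ('p, 'i, 'v::cvec) retriv \<Rightarrow>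
   ('p, 'i, 'v) gerbe \<Rightarrow> ('i \<Rightarrow> ('p, 'a, 'v) conn) \<Rightarrow> ('p \<Rightarrow> 'a \<Rightarrow> 'b) \<Rightarrow>
   ('p, 'i, 'a) conn1 \<Rightarrow> ('p, 'i, 'b) conn1 \<Rightarrow> bool"
where
  "conn1_retriv \<O> A R G' \<Delta> \<psi> B B' \<longleftrightarrow> (\<forall>j. \<exists>F.
     is_curvature \<O> A (cover G' j) (rline R j) (\<Delta> j) F \<and>
     (\<forall>p\<in>cover G' j. \<forall>a\<in>fib A p. \<forall>b\<in>fib A p. B' j p (\<psi> p a) (\<psi> p b) = B (rtau R j) p a b - F p a b))"

definition is_retrivialization ::
  "'p::topological_space fsheaf \<Rightarrow> ('p, 'i, 'v::cvec) retriv \<Rightarrow> ('p, 'i, 'v) gerbe \<Rightarrow> ('p, 'i, 'p tvec, 'v) conn0 \<Rightarrow>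
   ('p, 'i, 'v) gerbe \<Rightarrow> ('p, 'i, 'p tvec, 'v) conn0 \<Rightarrow> bool"
where
  "is_retrivialization \<O> R G \<delta> G' \<delta>' \<longleftrightarrow>
     gerbe_retriv \<O> R G G' \<and>
     conn0_retriv \<O> (tangent_algebroid \<O>) R G G' (rconn R) (\<lambda>p v. v) \<delta> \<delta>' \<and>
     (\<forall>j. is_curvature \<O> (tangent_algebroid \<O>) (cover G' j) (rline R j) (rconn R j) (rcurv R j))"

text \<open>
  The induced identification of the Courant algebroids: the curvature of the new \<open>\<delta>' j k\<close> is that
  of \<open>\<delta> (rtau R j) (rtau R k)\<close> plus \<open>rcurv R j\<close> minus \<open>rcurv R k\<close>, so the maps
  \<open>X + \<xi> \<mapsto> X + \<xi> - i_X (rcurv R j)\<close> on the members of the new cover are compatible with the gluings.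
\<close>

definition courant_retriv ::
  "'p::topological_space fsheaf \<Rightarrow> ('p, 'i, 'v) retriv \<Rightarrow> ('p, 'i, 'v) gerbe \<Rightarrow> 'p \<Rightarrow> ('p, 'i) evec \<Rightarrow> ('p, 'i) evec"
where
  "courant_retriv \<O> R G' p e = (fst e,
     (\<lambda>j v. if p \<in> cover G' j \<and> v \<in> tangent_space \<O> p
            then snd e (rtau R j) v - rcurv R j p (fst e) v else 0))"

definition pull_conn :: "('p, 'a, 'z) algebroid_scheme \<Rightarrow> ('p, 'p tvec, 'v) conn \<Rightarrow> ('p, 'a, 'v) conn" where
  "pull_conn A \<delta> = (\<lambda>V s p a. \<delta> V s p (anchor A p a))"

end

theory Submission
  imports Defs
begin

text \<open>
  The \<open>D\<close>-connections on the \<open>L\<^sub>i\<^sub>j\<close> are the pullbacks of the given connections along the anchor, and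
  the 1-connection is \<open>B\<^sub>i(X + \<xi>, Y + \<eta>) = \<xi>\<^sub>i(Y)\<close>. Isotropy makes \<open>B\<^sub>i\<close> alternating, and the gluing
  rule \<open>\<xi>\<^sub>j = \<xi>\<^sub>i + i\<^sub>X F\<^sub>i\<^sub>j\<close> of the Courant algebroid is the required relation
  \<open>B\<^sub>j - B\<^sub>i = F\<^sub>i\<^sub>j\<close>. In \<open>d B\<^sub>i\<close>, expanding the bracket of the first two arguments cancels all
  derivatives. What is left cancels because the bracket of two sections of \<open>D\<close> is again a section
  of \<open>D\<close>, and so is orthogonal to the third one.
\<close>

section \<open>Smooth functions, 2-forms and curvature\<close>

lemma C_k_on_zero: "C_k_on K n k V (\<lambda>x. 0)"
proof (induction k)
  case (Suc k)
  then have "\<exists>g. C_k_on K n k V g \<and> (\<forall>x\<in>V. ((\<lambda>t. 0) has_field_derivative g x) (at (x i) within K))"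
    for i
    by (intro exI[of _ "\<lambda>x. 0"]) auto
  then show ?case by simp
qed simp

lemma C_k_on_diff: "C_k_on K n k V f \<Longrightarrow> C_k_on K n k V g \<Longrightarrow> C_k_on K n k V (\<lambda>x. f x - g x)"
proof (induction k arbitrary: f g)
  case 0
  then show ?case by (simp add: continuous_on_diff)
next
  case (Suc k)
  have "\<exists>h. C_k_on K n k V h \<and>
      (\<forall>x\<in>V. ((\<lambda>t. f (x(i := t)) - g (x(i := t))) has_field_derivative h x) (at (x i) within K))"
    if i: "i < n" for i
  proof -
    obtain f' where f': "C_k_on K n k V f'"
      "\<forall>x\<in>V. ((\<lambda>t. f (x(i := t))) has_field_derivative f' x) (at (x i) within K)"
      using Suc.prems(1) i by auto
    obtain g' where g': "C_k_on K n k V g'"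
      "\<forall>x\<in>V. ((\<lambda>t. g (x(i := t))) has_field_derivative g' x) (at (x i) within K)"
      using Suc.prems(2) i by auto
    show ?thesis
      using Suc.IH[OF f'(1) g'(1)] f'(2) g'(2) by (intro exI[of _ "\<lambda>x. f' x - g' x"]) (auto intro: DERIV_diff)
  qed
  then show ?case using Suc.prems by (auto intro: continuous_on_diff)
qed

lemma structure_sheaf_zero: "(\<lambda>p. 0) \<in> structure_sheaf K n \<A> V"
  by (auto simp: structure_sheaf_def rst_def smooth_on_def C_k_on_zero)

lemma structure_sheaf_diff:
  assumes "f \<in> structure_sheaf K n \<A> V" "g \<in> structure_sheaf K n \<A> V"
  shows "(\<lambda>p. f p - g p) \<in> structure_sheaf K n \<A> V"
proof -
  have "rst V (\<lambda>p. f p - g p) = (\<lambda>p. rst V f p - rst V g p)"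
    by (auto simp: rst_def)
  then show ?thesis
    using assms by (auto simp: structure_sheaf_def smooth_on_def intro!: C_k_on_diff)
qed

text \<open>Needed because \<open>is_curvature\<close> asks \<open>B j - B i\<close> to be a
  2-form.\<close>

lemma two_form_diff:
  assumes diff: "\<And>V f g. f \<in> \<O> V \<Longrightarrow> g \<in> \<O> V \<Longrightarrow> (\<lambda>p. f p - g p) \<in> \<O> V"
    and "two_form \<O> A W \<omega>" "two_form \<O> A W \<eta>"
  shows "two_form \<O> A W (\<lambda>p a b. \<omega> p a b - \<eta> p a b)"
proof -
  have "rst V (\<lambda>p. \<omega> p (a p) (b p) - \<eta> p (a p) (b p)) \<in> \<O> V"
    if "open V \<and> V \<subseteq> W" "a \<in> sec A V" "b \<in> sec A V" for V a b
  proof -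
    have eq: "rst V (\<lambda>p. \<omega> p (a p) (b p) - \<eta> p (a p) (b p)) =
        (\<lambda>p. rst V (\<lambda>p. \<omega> p (a p) (b p)) p - rst V (\<lambda>p. \<eta> p (a p) (b p)) p)"
      by (auto simp: rst_def)
    show ?thesis
      unfolding eq using assms(2,3) that by (intro diff) (auto simp: two_form_def)
  qed
  then show ?thesis
    using assms(2,3) by (simp add: two_form_def clinear_on_def scaleC_complex_def algebra_simps)
qed

lemma two_form_subset: "two_form \<O> A W \<omega> \<Longrightarrow> W' \<subseteq> W \<Longrightarrow> two_form \<O> A W' \<omega>"
  unfolding two_form_def by (meson subsetD subset_trans)

lemma is_curvatureD:
  assumes "is_curvature \<O> A W L \<gamma> F" "open V" "V \<subseteq> W"
    and "a \<in> sec A V" "b \<in> sec A V" "s \<in> sec L V" "p \<in> V"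
  shows "F p (a p) (b p) *\<^sub>C s p =
      cov_deriv \<gamma> V a (cov_deriv \<gamma> V b s) p - cov_deriv \<gamma> V b (cov_deriv \<gamma> V a s) p
      - cov_deriv \<gamma> V (brk A V a b) s p"
  using assms unfolding is_curvature_def by blast

lemma clinear_on_fst:
  fixes S :: "('a::cvec \<times> 'b::cvec) set"
  assumes "clinear_on T f" "fst ` S \<subseteq> T"
  shows "clinear_on S (\<lambda>x. f (fst x))"
  using assms by (auto simp: clinear_on_def scaleC_prod_def image_subset_iff)

lemma tangent_algebroid_simps:
  "fib (tangent_algebroid \<O>) = tangent_space \<O>"
  "anchor (tangent_algebroid \<O>) p v = v"
  "brk (tangent_algebroid \<O>) V X Y = rst V (lie_bracket \<O> X Y)"
  by (simp_all add: tangent_algebroid_def)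

section \<open>The Lie algebroid of the subbundle\<close>

locale involutive_isotropic_subbundle =
  fixes \<O> :: "'p::topological_space fsheaf"
    and G :: "('p, 'i, 'v::cvec) gerbe"
    and \<delta> :: "('p, 'i, 'p tvec, 'v) conn0"
    and D :: "'p \<Rightarrow> ('p, 'i) evec set"
  assumes subbundle: "subbundle (courant_bundle \<O> G \<delta>) D"
    and isotropic: "isotropic G D"
    and involutive: "involutive \<O> G \<delta> D"
begin

abbreviation T where "T \<equiv> tangent_algebroid \<O>"
abbreviation A where "A \<equiv> sub_algebroid \<O> G \<delta> D"

lemma fib_A [simp]: "fib A = D"
  and sec_A: "sec A V = sub_sec (courant_bundle \<O> G \<delta>) D V"
  and anchor_A [simp]: "anchor A p e = fst e"
  by (simp_all add: sub_algebroid_def)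

lemma fib_subset: "e \<in> D p \<Longrightarrow> e \<in> courant_fibre \<O> G \<delta> p"
  using subbundle by (auto simp: subbundle_def courant_bundle_def)

lemma fst_in_tangent_space: "e \<in> D p \<Longrightarrow> fst e \<in> tangent_space \<O> p"
  using fib_subset[of e p] by (auto simp: courant_fibre_def)

lemma clinear_on_covector:
  assumes "e \<in> D p" "p \<in> cover G i"
  shows "clinear_on (tangent_space \<O> p) (snd e i)"
proof -
  have "snd e i \<in> fib (dual_bundle \<O> T) p"
    using fib_subset[OF assms(1)] assms(2) by (force simp: courant_fibre_def)
  then show ?thesis by (simp add: dual_bundle_def tangent_algebroid_simps)
qed

lemma section_mem: "a \<in> sec A V \<Longrightarrow> p \<in> V \<Longrightarrow> a p \<in> D p"
  by (simp add: sec_A sub_sec_def)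

lemma fst_section: "a \<in> sec A V \<Longrightarrow> (\<lambda>p. fst (a p)) \<in> sec T V"
  by (simp add: sec_A sub_sec_def courant_bundle_def)

lemma covector_section:
  assumes "a \<in> sec A V" "V \<subseteq> cover G i"
  shows "rst V (\<lambda>p. snd (a p) i) \<in> sec (dual_bundle \<O> T) V"
proof -
  have "V \<inter> cover G i = V" using assms(2) by blast
  moreover have "rst (V \<inter> cover G i) (\<lambda>p. snd (a p) i) \<in> sec (dual_bundle \<O> T) (V \<inter> cover G i)"
    using assms(1) by (simp add: sec_A sub_sec_def courant_bundle_def)
  ultimately show ?thesis by simp
qed

text \<open>Involutivity supplies a witness for the \<open>SOME\<close> in \<open>brk\<close>; from
  here on the bracket is used only through these two facts.\<close>

lemma bracket:
  assumes "open V" "a \<in> sec A V" "b \<in> sec A V"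
  shows "brk A V a b \<in> sec A V" "is_courant_bracket \<O> G \<delta> V a b (brk A V a b)"
proof -
  have "\<exists>c. c \<in> sub_sec (courant_bundle \<O> G \<delta>) D V \<and> is_courant_bracket \<O> G \<delta> V a b c"
    using involutive assms unfolding involutive_def sec_A by blast
  from someI_ex[OF this]
  show "brk A V a b \<in> sec A V" "is_courant_bracket \<O> G \<delta> V a b (brk A V a b)"
    by (simp_all add: sub_algebroid_def)
qed

text \<open>This lets curvature identities pull back along the anchor.\<close>

lemma fst_bracket:
  assumes "open V" "a \<in> sec A V" "b \<in> sec A V" "p \<in> V"
  shows "fst (brk A V a b p) = lie_bracket \<O> (\<lambda>q. fst (a q)) (\<lambda>q. fst (b q)) p"
  using bracket(2)[OF assms(1-3)] assms(4) by (simp add: is_courant_bracket_def)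

section \<open>Pullback along the anchor\<close>

lemma connection_pull:
  assumes "connection \<O> T W L \<gamma>"
  shows "connection \<O> A W L (pull_conn A \<gamma>)"
  unfolding connection_def pull_conn_def anchor_A fib_A
\<comment> \<open>The cases run through the conditions of \<open>connection\<close> in order; each
  one is the condition over the tangent bundle in the direction \<open>fst a\<close>.\<close>
proof (intro allI impI ballI conjI, goal_cases)
  case (1 V s p)
  show ?case
    using assms 1 fst_in_tangent_space[of _ p]
    by (intro clinear_on_fst[where T="tangent_space \<O> p"])
      (auto simp: connection_def tangent_algebroid_simps)
next
  case (2 V s p)
  then have "\<gamma> V s p ` tangent_space \<O> p \<subseteq> fib L p"
    using assms by (simp add: connection_def tangent_algebroid_simps)
  then show ?case
    using fst_in_tangent_space[of _ p] by blast
next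
  case (3 V s V' a)
  then show ?case
    using assms fst_section[of a V'] by (simp add: connection_def)
next
  case (4 V s V' p a)
  then show ?case
    using assms fst_in_tangent_space[of a p] by (simp add: connection_def tangent_algebroid_simps)
next
  case (5 V s t p a)
  then show ?case
    using assms fst_in_tangent_space[of a p] by (simp add: connection_def tangent_algebroid_simps)
next
  case (6 V s f p a)
  then show ?case
    using assms fst_in_tangent_space[of a p] by (simp add: connection_def tangent_algebroid_simps)
qed

lemma cov_deriv_pull: "cov_deriv (pull_conn A \<gamma>) V a s = cov_deriv \<gamma> V (\<lambda>p. fst (a p)) s"
  by (simp add: cov_deriv_def pull_conn_def)

text \<open>Kept apart from the 2-form condition, so that it can be used at a single point
  \<open>p\<close> with an \<open>F\<close> obtained for that \<open>p\<close>.\<close>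

lemma curvature_identity_pull:
  assumes "is_curvature \<O> T W L \<gamma> F" "open V" "V \<subseteq> W"
    and "a \<in> sec A V" "b \<in> sec A V" "s \<in> sec L V" "p \<in> V"
  shows "F p (fst (a p)) (fst (b p)) *\<^sub>C s p =
      cov_deriv (pull_conn A \<gamma>) V a (cov_deriv (pull_conn A \<gamma>) V b s) p
      - cov_deriv (pull_conn A \<gamma>) V b (cov_deriv (pull_conn A \<gamma>) V a s) p
      - cov_deriv (pull_conn A \<gamma>) V (brk A V a b) s p"
proof -
  \<comment> \<open>The covariant derivative at \<open>p \<in> V\<close> sees only the value of the
    direction at \<open>p\<close>, so the cut-off \<open>rst V\<close> in the bracket of
    \<open>T\<close> does no harm.\<close>
  have "cov_deriv \<gamma> V (\<lambda>p. fst (brk A V a b p)) s p =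
      cov_deriv \<gamma> V (brk T V (\<lambda>p. fst (a p)) (\<lambda>p. fst (b p))) s p"
    using assms by (simp add: cov_deriv_def rst_def tangent_algebroid_simps fst_bracket)
  then show ?thesis
    using is_curvatureD[OF assms(1-3) fst_section[OF assms(4)] fst_section[OF assms(5)] assms(6,7)]
    by (simp add: cov_deriv_pull)
qed

lemma two_form_pull:
  assumes "two_form \<O> T W F"
  shows "two_form \<O> A W (\<lambda>p a b. F p (fst a) (fst b))"
proof -
  have "clinear_on (D p) (\<lambda>b. F p (fst a) (fst b)) \<and> clinear_on (D p) (\<lambda>b. F p (fst b) (fst a)) \<and>
      F p (fst a) (fst a) = 0" if "p \<in> W" "a \<in> D p" for p a
    using assms that fst_in_tangent_space[of _ p]
    by (intro conjI clinear_on_fst[where T="tangent_space \<O> p"])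
      (auto simp: two_form_def tangent_algebroid_simps intro: clinear_on_fst)
  then show ?thesis
    using assms fst_section unfolding two_form_def fib_A by simp
qed

lemma is_curvature_pull:
  assumes "is_curvature \<O> T W L \<gamma> F"
  shows "is_curvature \<O> A W L (pull_conn A \<gamma>) (\<lambda>p a b. F p (fst a) (fst b))"
  unfolding is_curvature_def
proof (intro conjI allI impI ballI)
  show "two_form \<O> A W (\<lambda>p a b. F p (fst a) (fst b))"
    using assms by (intro two_form_pull) (simp add: is_curvature_def)
qed (use curvature_identity_pull[OF assms] in blast)

text \<open>Stated for any \<open>sub_algebroid\<close>, since a change of trivialization leads to
  the one of another gerbe.\<close>

lemma pull_conn_apply: "pull_conn (sub_algebroid \<O>' G' \<delta>' D') \<gamma> V s p e = \<gamma> V s p (fst e)"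
  by (simp add: pull_conn_def sub_algebroid_def)

lemma zero_connection_pull:
  assumes "zero_connection \<O> T G \<delta>"
  shows "zero_connection \<O> A G (\<lambda>i j. pull_conn A (\<delta> i j))"
  unfolding zero_connection_def
proof (intro conjI allI impI ballI)
  show "connection \<O> A (cover G i \<inter> cover G j) (lb G i j) (pull_conn A (\<delta> i j))" for i j
    using assms by (intro connection_pull) (simp add: zero_connection_def)
qed (use assms in \<open>simp_all add: zero_connection_def pull_conn_def tangent_algebroid_simps fst_in_tangent_space\<close>)

section \<open>The 1-connection\<close>

definition covector_form :: "'i \<Rightarrow> 'p \<Rightarrow> ('p, 'i) evec \<Rightarrow> ('p, 'i) evec \<Rightarrow> complex" where
  "covector_form i p e e' = snd e i (fst e')"

text \<open>Isotropy reads \<open>\<xi>(Y) + \<eta>(X) = 0\<close>. Hence on \<open>D\<close> the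
  form agrees with the skew pairing \<open>(\<xi>(Y) - \<eta>(X)) / 2\<close>.\<close>

lemma covector_form_antisym:
  assumes "e \<in> D p" "e' \<in> D p" "p \<in> cover G i"
  shows "covector_form i p e e' = - covector_form i p e' e"
proof -
  have "courant_pairing i e e' = 0"
    using isotropic assms by (auto simp: isotropic_def)
  then show ?thesis
    by (simp add: courant_pairing_def covector_form_def eq_neg_iff_add_eq_0)
qed

lemma two_form_covector_form: "two_form \<O> A (cover G i) (covector_form i)"
  unfolding two_form_def fib_A
proof (intro conjI ballI allI impI, goal_cases)
  case (1 p a)
  then show ?case
    unfolding covector_form_def
    using fst_in_tangent_space by (intro clinear_on_fst[OF clinear_on_covector]) auto
next
  case (2 p a)
  show ?case
    by (auto simp: covector_form_def clinear_on_def scaleC_prod_def scaleC_fun_def)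
next
  \<comment> \<open>With equal arguments antisymmetry reads \<open>x = - x\<close>, so
    \<open>x = 0\<close>.\<close>
  case (3 p a)
  then show ?case
    using covector_form_antisym[of a p a i] by simp
next
  case (4 V a b)
  \<comment> \<open>Sections of the dual bundle are extended by zero, hence the inner
    \<open>rst V\<close>; the outer one absorbs it.\<close>
  have "rst V (\<lambda>p. rst V (\<lambda>p. snd (a p) i) p (fst (b p))) \<in> \<O> V"
    using covector_section[of a V i] fst_section[of b V] 4 by (auto simp: dual_bundle_def)
  moreover have "rst V (\<lambda>p. rst V (\<lambda>p. snd (a p) i) p (fst (b p))) = rst V (\<lambda>p. covector_form i p (a p) (b p))"
    by (auto simp: rst_def covector_form_def)
  ultimately show ?case by simp
qed

text \<open>
  The curvature \<open>F\<close> of \<open>\<delta> i j\<close> is the one that the gluing condition provides at \<open>p\<close>, so neither its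
  existence nor its uniqueness has to be proved separately.
\<close>

lemma is_curvature_covector_form:
  assumes "\<And>V f g. f \<in> \<O> V \<Longrightarrow> g \<in> \<O> V \<Longrightarrow> (\<lambda>p. f p - g p) \<in> \<O> V"
  shows "is_curvature \<O> A (cover G i \<inter> cover G j) (lb G i j) (pull_conn A (\<delta> i j))
    (\<lambda>p a b. covector_form j p a b - covector_form i p a b)"
  unfolding is_curvature_def
proof (intro conjI allI impI ballI, goal_cases)
  case 1
  show ?case
    by (intro two_form_diff assms two_form_subset[OF two_form_covector_form]) auto
next
  case (2 V a b s p)
  then have p: "p \<in> cover G i \<inter> cover G j" "a p \<in> D p" "b p \<in> D p"
    using section_mem by auto
  obtain F where F: "is_curvature \<O> T (cover G i \<inter> cover G j) (lb G i j) (\<delta> i j) F"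
    "\<forall>v\<in>tangent_space \<O> p. snd (a p) j v = snd (a p) i v + F p (fst (a p)) v"
    using fib_subset[OF p(2)] p(1) by (force simp: courant_fibre_def)
  have "covector_form j p (a p) (b p) - covector_form i p (a p) (b p) = F p (fst (a p)) (fst (b p))"
    using F(2) fst_in_tangent_space[OF p(3)] by (simp add: covector_form_def)
  then show ?case
    using curvature_identity_pull[OF F(1)] 2 by simp
qed

lemma d_covector_form:
  assumes V: "open V" "V \<subseteq> cover G i" "p \<in> V"
    and abc: "a \<in> sec A V" "b \<in> sec A V" "c \<in> sec A V"
  shows "d_two_form A V (covector_form i) a b c p = 0"
proof -
  \<comment> \<open>The bracket formula, tested on the vector field \<open>Z = fst c\<close> over
    all of \<open>V\<close>.\<close>
  have "snd (brk A V a b p) i (fst (c p)) =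
      lie_deriv_form \<O> (\<lambda>q. fst (a q)) (\<lambda>q. snd (b q) i) (\<lambda>q. fst (c q)) p
      - d_one_form \<O> (\<lambda>q. snd (a q) i) (\<lambda>q. fst (b q)) (\<lambda>q. fst (c q)) p"
    using bracket(2)[OF V(1) abc(1,2)] V fst_section[OF abc(3)]
    unfolding is_courant_bracket_def by (metis (no_types, lifting) Int_subset_iff order_refl)
  \<comment> \<open>With \<open>fst_bracket\<close>, these turn the last two terms of
    \<open>d_two_form\<close> into \<open>- \<eta>([X, Z])\<close> and \<open>\<xi>([Y, Z])\<close>,
    where \<open>a = X + \<xi>\<close> and \<open>b = Y + \<eta>\<close>. They cancel what the Lie
    derivative and \<open>d_one_form\<close> leave over.\<close>
  moreover have "covector_form i p (brk A V a c p) (b p) = - covector_form i p (b p) (brk A V a c p)"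
    "covector_form i p (brk A V b c p) (a p) = - covector_form i p (a p) (brk A V b c p)"
    using V abc by (auto intro!: covector_form_antisym section_mem bracket(1))
  ultimately show ?thesis
    using V abc
    by (simp add: d_two_form_def lie_deriv_form_def d_one_form_def covector_form_def fst_bracket)
qed

section \<open>Flatness and independence of the trivialization\<close>

lemma flat_gerbe_connection_covector_form:
  assumes "zero_connection \<O> T G \<delta>"
    and "\<And>V. (\<lambda>p. 0) \<in> \<O> V"
    and "\<And>V f g. f \<in> \<O> V \<Longrightarrow> g \<in> \<O> V \<Longrightarrow> (\<lambda>p. f p - g p) \<in> \<O> V"
  shows "flat_gerbe_connection \<O> A G (\<lambda>i j. pull_conn A (\<delta> i j), covector_form)"
proof -
  have "three_form \<O> A UNIV (\<lambda>p a b c. 0)"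
    using assms(2) by (auto simp: three_form_def clinear_on_def scaleC_complex_def rst_def)
  moreover have "is_curvature \<O> A (cover G i \<inter> cover G j) (lb G i j) (pull_conn A (\<delta> i j))
      (\<lambda>p a b. covector_form j p a b - covector_form i p a b)" for i j
    by (intro is_curvature_covector_form assms(3))
  ultimately show ?thesis
    unfolding flat_gerbe_connection_def gerbe_connection_def is_curving_def
    using zero_connection_pull[OF assms(1)]
    by (simp add: two_form_covector_form d_covector_form)
qed

text \<open>\<open>courant_retriv\<close> keeps the vector part, so the pulled-back 0-connections
  transform like the given ones. It subtracts \<open>i_X (rcurv R j)\<close> from the covector,
  which is the rule \<open>B - F\<close> for 1-connections. \<open>D'\<close> is arbitrary because
  \<open>pull_conn\<close> sees only the anchor \<open>fst\<close>.\<close>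

lemma retrivialization:
  assumes "is_retrivialization \<O> R G \<delta> G' \<delta>'"
  shows "conn0_retriv \<O> A R G G' (\<lambda>j. pull_conn A (rconn R j)) (courant_retriv \<O> R G')
      (\<lambda>i j. pull_conn A (\<delta> i j)) (\<lambda>i j. pull_conn (sub_algebroid \<O> G' \<delta>' D') (\<delta>' i j))"
    and "conn1_retriv \<O> A R G' (\<lambda>j. pull_conn A (rconn R j)) (courant_retriv \<O> R G')
      covector_form (\<lambda>i p e e'. snd e i (fst e'))"
proof -
  \<comment> \<open>The condition that defines the dual connection involves \<open>a\<close> only
    through \<open>fst a\<close>.\<close>
  have dual: "dual_conn \<O> A L (pull_conn A \<gamma>) V \<phi> p a = dual_conn \<O> T L \<gamma> V \<phi> p (fst a)" for L \<gamma> V \<phi> p a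
    by (simp add: dual_conn_def pull_conn_def tangent_algebroid_simps)
  have c0: "conn0_retriv \<O> T R G G' (rconn R) (\<lambda>p v. v) \<delta> \<delta>'"
    and curv: "\<And>j. is_curvature \<O> T (cover G' j) (rline R j) (rconn R j) (rcurv R j)"
    using assms by (auto simp: is_retrivialization_def)
  show "conn0_retriv \<O> A R G G' (\<lambda>j. pull_conn A (rconn R j)) (courant_retriv \<O> R G')
      (\<lambda>i j. pull_conn A (\<delta> i j)) (\<lambda>i j. pull_conn (sub_algebroid \<O> G' \<delta>' D') (\<delta>' i j))"
    unfolding conn0_retriv_def
  proof (intro conjI allI impI ballI, goal_cases)
    case (1 j)
    then show ?case using c0 by (intro connection_pull) (simp add: conn0_retriv_def)
  next
    case (2 j k V s t \<phi> p a)
    then show ?case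
      using c0 fst_in_tangent_space[of a p]
      by (simp add: conn0_retriv_def dual courant_retriv_def tangent_algebroid_simps pull_conn_apply)
  qed
  show "conn1_retriv \<O> A R G' (\<lambda>j. pull_conn A (rconn R j)) (courant_retriv \<O> R G')
      covector_form (\<lambda>i p e e'. snd e i (fst e'))"
    unfolding conn1_retriv_def
    \<comment> \<open>The witness for \<open>F\<close> is the pullback of \<open>rcurv R j\<close>.
      Since \<open>fst\<close> of an element of \<open>D\<close> is tangent, the default value
      \<open>0\<close> in \<open>courant_retriv\<close> does not occur.\<close>
    using is_curvature_pull[OF curv] fst_in_tangent_space
    by (intro allI exI conjI) (auto simp: courant_retriv_def covector_form_def)
qed

end

theorem theorem1p15:
  fixes K :: "complex set" and n :: nat
    and \<A> :: "'p::{t2_space, second_countable_topology} chart set"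
    and \<O> :: "'p fsheaf"
  assumes "K = \<real> \<or> K = UNIV"
    and "manifold_atlas K n \<A>"
    and "\<O> = structure_sheaf K n \<A>"
  shows "\<exists>\<Phi> :: ('p, 'i, 'v::cvec) gerbe \<Rightarrow> ('p, 'i, 'p tvec, 'v) conn0 \<Rightarrow> ('p \<Rightarrow> ('p, 'i) evec set) \<Rightarrow>
      ('p, 'i, ('p, 'i) evec, 'v) conn0 \<times> ('p, 'i, ('p, 'i) evec) conn1.
    \<forall>G \<delta> D.
      gerbe \<O> G \<and> zero_connection \<O> (tangent_algebroid \<O>) G \<delta> \<and>
      subbundle (courant_bundle \<O> G \<delta>) D \<and> isotropic G D \<and> involutive \<O> G \<delta> D \<longrightarrow>
        flat_gerbe_connection \<O> (sub_algebroid \<O> G \<delta> D) G (\<Phi> G \<delta> D) \<and>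
        (\<forall>R G' \<delta>'.
          gerbe \<O> G' \<and> zero_connection \<O> (tangent_algebroid \<O>) G' \<delta>' \<and>
          is_retrivialization \<O> R G \<delta> G' \<delta>' \<longrightarrow>
            (let A = sub_algebroid \<O> G \<delta> D;
                 \<psi> = courant_retriv \<O> R G';
                 \<Delta> = (\<lambda>j. pull_conn A (rconn R j));
                 C = \<Phi> G \<delta> D;
                 C' = \<Phi> G' \<delta>' (\<lambda>p. \<psi> p ` D p)
             in conn0_retriv \<O> A R G G' \<Delta> \<psi> (fst C) (fst C') \<and>
                conn1_retriv \<O> A R G' \<Delta> \<psi> (snd C) (snd C')))"
\<comment> \<open>One formula, without choices, serves all gerbes; so the value of
  \<open>\<Phi>\<close> on \<open>G'\<close> can be compared with that on \<open>G\<close>.\<close>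
proof (intro exI[where x="\<lambda>G \<delta> D.
    (\<lambda>i j. pull_conn (sub_algebroid \<O> G \<delta> D) (\<delta> i j), \<lambda>i p e e'. snd e i (fst e'))"]
    allI impI, elim conjE, goal_cases)
  case (1 G \<delta> D)
  then interpret involutive_isotropic_subbundle \<O> G \<delta> D
    by unfold_locales
  have form: "covector_form = (\<lambda>i p e e'. snd e i (fst e'))"
    by (simp add: covector_form_def fun_eq_iff)
  have "flat_gerbe_connection \<O> A G (\<lambda>i j. pull_conn A (\<delta> i j), covector_form)"
    using 1(2) by (intro flat_gerbe_connection_covector_form)
      (simp_all add: assms(3) structure_sheaf_zero structure_sheaf_diff)
  \<comment> \<open>Here \<open>D'\<close> in \<open>retrivialization\<close> is the image of
    \<open>D\<close> under \<open>courant_retriv \<O> R G'\<close>.\<close>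
  then show ?case
    using retrivialization unfolding form Let_def fst_conv snd_conv by blast
qed

end
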